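(* Suppose that for every follower $i\in\{1,\dots,n\}$ the maps $y_i\mapsto\theta_i(x,y_i,y_{-i})$ and $y_i\mapsto g_{i,j}(x,y_i)$ ($j=1,\dots,p_i$) are convex (for all values of the remaining variables). Let $(\bar x,\bar y)$ be a local solution of the single-leader multi-follower game (SLMFG), and suppose that for every follower $i$ Slater's constraint qualification is satisfied at $x=\bar x$. Then there exists $\bar\mu=(\bar\mu_{i,j})_{i=1,\dots,n;\ j=1,\dots,p_i}\ge 0$ such that $(\bar x,\bar y,\bar\mu)$ is a local solution of the MPCC reformulation (MPCC).
   Context: Setting. There is one leader with decision variable $x\in\mathbb{R}^{n_0}$, restricted to a set $X\subset\mathbb{R}^{n_0}$, and with objective $\theta_0:\mathbb{R}^{n_0}\times\prod_{i=1}^n\mathbb{R}^{n_i}\to\mathbb{R}$. There are $n$ followers; follower $i$ has decision variable $y_i\in\mathbb{R}^{n_i}$. Write $y=(y_1,\dots,y_n)=(y_i,y_{-i})$, where $y_{-i}$ collects the decisions of the followers other than $i$. Follower $i$ has objective $\theta_i(x,y_i,y_{-i})\in\mathbb{R}$ and constraint functions $g_{i,j}:\mathbb{R}^{n_0}\times\mathbb{R}^{n_i}\to\mathbb{R}$, $j=1,\dots,p_i$, with feasible set $Y_i(x)=\{y_i : g_{i,j}(x,y_i)\le 0\ \forall j\}$. Write $g_i=(g_{i,1},\dots,g_{i,p_i})$. Standing smoothness assumption: $y_i\mapsto\theta_i(x,y_i,y_{-i})$ and $y_i\mapsto g_{i,j}(x,y_i)$ are continuously differentiable, and the gradients $\nabla_{y_i}\theta_i(x,y_i,y_{-i})$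 and $\nabla_{y_i}g_{i,j}(x,y_i)$ are continuous in all of their variables. Nash equilibria. $\mathrm{NEP}(x)$ is the set of $y$ such that, for every $i$, $y_i$ minimizes $\theta_i(x,\cdot,y_{-i})$ over $Y_i(x)$. (SLMFG): minimize $\theta_0(x,y)$ over $(x,y)$ subject to $x\in X$ and $y\in\mathrm{NEP}(x)$. (MPCC): minimize $\theta_0(x,y)$ over $(x,y,\mu)$ with $\mu=(\mu_1,\dots,\mu_n)$, $\mu_i\in\mathbb{R}^{p_i}$, subject to $x\in X$ and, for every $i$, $$\nabla_{y_i}\theta_i(x,y_i,y_{-i})+\sum_{j=1}^{p_i}\mu_{i,j}\nabla_{y_i}g_{i,j}(x,y_i)=0,\quad g_i(x,y_i)\le 0,\quad \mu_i\ge 0,\quad \langle\mu_i,g_i(x,y_i)\rangle=0.$$ Slater's constraint qualification for follower $i$ at $x$: there is $y_i\in\mathbb{R}^{n_i}$ with $g_{i,j}(x,y_i)<0$ for all $j=1,\dots,p_i$. A local solution of a problem is a feasible point that minimizes the objective among all feasible points in some neighborhood of it; in (MPCC) the neighborhood is taken in the space of triples $(x,y,\mu)$. *)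

theory Defs
  imports "HOL-Analysis.Analysis"
begin

text \<open>
  The dimensions \<open>n\<^sub>i\<close> of the followers' decision spaces and the numbers \<open>p\<^sub>i\<close> of their constraints
  depend on the follower \<open>i\<close>, so they cannot be turned into types. The space of dimension \<open>n\<^sub>i\<close> is
  represented as the coordinate subspace of a common space \<open>real ^ 'd\<close> that belongs to a set
  \<open>D i\<close> of \<open>n\<^sub>i\<close> coordinates, and the constraints of follower \<open>i\<close> are indexed by a set \<open>J i\<close> of
  \<open>p\<^sub>i\<close> elements of a common type \<open>'j\<close>. As \<open>'d\<close> and \<open>'j\<close> may be arbitrarily large, every family of
  dimensions and numbers of constraints (including \<open>p\<^sub>i = 0\<close>) is covered. The functions of the
  problem are total on the ambient types, but only their values on the coordinate subspaces are
  ever used.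
\<close>

definition coord_space :: "'d set \<Rightarrow> (real ^ 'd::finite) set" where
  "coord_space D = {v. \<forall>k. k \<notin> D \<longrightarrow> v $ k = 0}"

lemma subspace_coord_space: "subspace (coord_space D)"
  by (auto simp: coord_space_def subspace_def)

lemma dim_coord_space: "dim (coord_space D) = card D"
  unfolding coord_space_def by (simp add: dim_substandard_cart flip: dim_vec_eq)

definition profiles :: "('f \<Rightarrow> 'd set) \<Rightarrow> ((real ^ 'd::finite) ^ 'f::finite) set" where
  "profiles D = {y. \<forall>i. y $ i \<in> coord_space (D i)}"

text \<open>The profile \<open>(z, y\<^bsub>-i\<^esub>)\<close>.\<close>

definition deviate :: "'b ^ 'f \<Rightarrow> 'f \<Rightarrow> 'b \<Rightarrow> 'b ^ 'f::finite" where
  "deviate y i z = (\<chi> k. if k = i then z else y $ k)"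

text \<open>
  The gradient of \<open>f\<close> at \<open>v\<close> as a function on the subspace \<open>S\<close> only. It is required to lie in \<open>S\<close>,
  which makes it unique for \<open>v \<in> S\<close>; for a coordinate subspace it consists of the usual partial
  derivatives.
\<close>

definition grad_on :: "'a::euclidean_space set \<Rightarrow> ('a \<Rightarrow> real) \<Rightarrow> 'a \<Rightarrow> 'a" where
  "grad_on S f v = (THE G. G \<in> S \<and> (f has_derivative (\<lambda>h. G \<bullet> h)) (at v within S))"

lemma grad_on_unique:
  fixes S :: "'a::euclidean_space set"
  assumes S: "subspace S" and v: "v \<in> S"
    and G: "G \<in> S" "(f has_derivative (\<lambda>h. G \<bullet> h)) (at v within S)"
    and H: "H \<in> S" "(f has_derivative (\<lambda>h. H \<bullet> h)) (at v within S)"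
  shows "G = H"
proof -
  define w where "w = G - H"
  have w: "w \<in> S" unfolding w_def using S G(1) H(1) by (rule subspace_diff)
  have range: "range (\<lambda>t::real. v + t *\<^sub>R w) \<subseteq> S"
    using S v w by (auto intro!: subspace_add subspace_scale)
  have line: "((\<lambda>t::real. f (v + t *\<^sub>R w)) has_derivative (\<lambda>t. K \<bullet> (t *\<^sub>R w))) (at 0)"
    if "(f has_derivative (\<lambda>h. K \<bullet> h)) (at v within S)" for K
  proof -
    have *: "((\<lambda>t::real. v + t *\<^sub>R w) has_derivative (\<lambda>t. t *\<^sub>R w)) (at 0)"
      by (auto intro!: derivative_eq_intros)
    have "(f has_derivative (\<lambda>h. K \<bullet> h))
        (at (v + 0 *\<^sub>R w) within range (\<lambda>t::real. v + t *\<^sub>R w))"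
      using has_derivative_subset[OF that range] by simp
    from has_derivative_in_compose[OF * this] show ?thesis by simp
  qed
  have "(\<lambda>t. G \<bullet> (t *\<^sub>R w)) = (\<lambda>t. H \<bullet> (t *\<^sub>R w))"
    by (rule has_derivative_unique[OF line[OF G(2)] line[OF H(2)]])
  from fun_cong[OF this, of 1] have "G \<bullet> w = H \<bullet> w" by simp
  then have "w \<bullet> w = 0" by (simp add: w_def inner_diff_left)
  then show ?thesis by (simp add: w_def)
qed

lemma grad_on_eq:
  assumes "subspace S" "v \<in> S" "G \<in> S" "(f has_derivative (\<lambda>h. G \<bullet> h)) (at v within S)"
  shows "grad_on S f v = G"
  unfolding grad_on_def using assms grad_on_unique[OF assms(1,2)] by (intro the_equality) auto

lemma grad_on_coord_space:
  fixes f :: "real ^ 'd \<Rightarrow> real"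
  assumes v: "v \<in> coord_space D" and f: "f differentiable (at v within coord_space D)"
  shows "grad_on (coord_space D) f v \<in> coord_space D"
    and "(f has_derivative (\<lambda>h. grad_on (coord_space D) f v \<bullet> h)) (at v within coord_space D)"
proof -
  let ?S = "coord_space D"
  obtain f' where f': "(f has_derivative f') (at v within ?S)"
    using f by (auto simp: differentiable_def)
  then have lin: "linear f'" by (rule has_derivative_linear)
  define G where "G = (\<chi> k. if k \<in> D then f' (axis k 1) else 0)"
  have G: "G \<in> ?S" by (simp add: G_def coord_space_def)
  have eq: "f' h = G \<bullet> h" if h: "h \<in> ?S" for h
  proof -
    have "f' h = f' (\<Sum>k\<in>UNIV. (h $ k) *\<^sub>R axis k 1)"
      by (simp add: basis_expansion scalar_mult_eq_scaleR[symmetric])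
    also have "\<dots> = (\<Sum>k\<in>UNIV. h $ k * f' (axis k 1))"
      by (simp add: linear_sum[OF lin] linear_cmul[OF lin])
    also have "\<dots> = (\<Sum>k\<in>UNIV. G $ k * h $ k)"
      using h by (intro sum.cong) (auto simp: G_def coord_space_def)
    finally show ?thesis by (simp add: inner_vec_def)
  qed
  have "(f has_derivative (\<lambda>h. G \<bullet> h)) (at v within ?S)"
    unfolding has_derivative_within
  proof
    show "bounded_linear (\<lambda>h. G \<bullet> h)" by (rule bounded_linear_inner_right)
    have "((\<lambda>z. (1 / norm (z - v)) *\<^sub>R (f z - (f v + f' (z - v)))) \<longlongrightarrow> 0) (at v within ?S)"
      using f' by (simp add: has_derivative_within)
    then show "((\<lambda>z. (1 / norm (z - v)) *\<^sub>R (f z - (f v + G \<bullet> (z - v)))) \<longlongrightarrow> 0) (at v within ?S)"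
    proof (rule Lim_transform_eventually)
      show "\<forall>\<^sub>F z in at v within ?S. (1 / norm (z - v)) *\<^sub>R (f z - (f v + f' (z - v)))
          = (1 / norm (z - v)) *\<^sub>R (f z - (f v + G \<bullet> (z - v)))"
        unfolding eventually_at_filter
        using v by (intro always_eventually) (simp add: eq subspace_diff[OF subspace_coord_space])
    qed
  qed
  with G v show "grad_on ?S f v \<in> ?S" "(f has_derivative (\<lambda>h. grad_on ?S f v \<bullet> h)) (at v within ?S)"
    by (simp_all add: grad_on_eq[OF subspace_coord_space])
qed

definition feasible ::
  "'d set \<Rightarrow> 'j set \<Rightarrow> ('j \<Rightarrow> 'x \<Rightarrow> real ^ 'd \<Rightarrow> real) \<Rightarrow> 'x \<Rightarrow> (real ^ 'd::finite) set" where
  "feasible D J g x = {v \<in> coord_space D. \<forall>j\<in>J. g j x v \<le> 0}"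

definition slater ::
  "'d set \<Rightarrow> 'j set \<Rightarrow> ('j \<Rightarrow> 'x \<Rightarrow> real ^ 'd::finite \<Rightarrow> real) \<Rightarrow> 'x \<Rightarrow> bool" where
  "slater D J g x \<longleftrightarrow> (\<exists>v\<in>coord_space D. \<forall>j\<in>J. g j x v < 0)"

definition NEP ::
  "('f \<Rightarrow> 'd set) \<Rightarrow> ('f \<Rightarrow> 'j set) \<Rightarrow> ('f \<Rightarrow> 'x \<Rightarrow> (real ^ 'd) ^ 'f \<Rightarrow> real) \<Rightarrow>
    ('f \<Rightarrow> 'j \<Rightarrow> 'x \<Rightarrow> real ^ 'd \<Rightarrow> real) \<Rightarrow> 'x \<Rightarrow> ((real ^ 'd::finite) ^ 'f::finite) set" where
  "NEP D J \<theta> g x =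
    {y \<in> profiles D. \<forall>i. y $ i \<in> feasible (D i) (J i) (g i) x \<and>
       (\<forall>z\<in>feasible (D i) (J i) (g i) x. \<theta> i x y \<le> \<theta> i x (deviate y i z))}"

definition SLMFG_feasible ::
  "'x set \<Rightarrow> ('f \<Rightarrow> 'd set) \<Rightarrow> ('f \<Rightarrow> 'j set) \<Rightarrow> ('f \<Rightarrow> 'x \<Rightarrow> (real ^ 'd) ^ 'f \<Rightarrow> real) \<Rightarrow>
    ('f \<Rightarrow> 'j \<Rightarrow> 'x \<Rightarrow> real ^ 'd \<Rightarrow> real) \<Rightarrow> ('x \<times> ((real ^ 'd::finite) ^ 'f::finite)) set" where
  "SLMFG_feasible X D J \<theta> g = {(x, y). x \<in> X \<and> y \<in> NEP D J \<theta> g x}"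

text \<open>The multiplier space of follower \<open>i\<close> is the coordinate subspace of \<open>real ^ 'j\<close> given by \<open>J i\<close>.\<close>

definition MPCC_feasible ::
  "'x set \<Rightarrow> ('f \<Rightarrow> 'd set) \<Rightarrow> ('f \<Rightarrow> 'j set) \<Rightarrow> ('f \<Rightarrow> 'x \<Rightarrow> (real ^ 'd) ^ 'f \<Rightarrow> real) \<Rightarrow>
    ('f \<Rightarrow> 'j \<Rightarrow> 'x \<Rightarrow> real ^ 'd \<Rightarrow> real) \<Rightarrow>
    ('x \<times> ((real ^ 'd::finite) ^ 'f::finite) \<times> ((real ^ 'j::finite) ^ 'f)) set" where
  "MPCC_feasible X D J \<theta> g =
    {(x, y, \<mu>). x \<in> X \<and> y \<in> profiles D \<and> \<mu> \<in> profiles J \<and>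
      (\<forall>i. grad_on (coord_space (D i)) (\<lambda>z. \<theta> i x (deviate y i z)) (y $ i)
             + (\<Sum>j\<in>J i. (\<mu> $ i $ j) *\<^sub>R grad_on (coord_space (D i)) (g i j x) (y $ i)) = 0 \<and>
           (\<forall>j\<in>J i. g i j x (y $ i) \<le> 0) \<and>
           (\<forall>j\<in>J i. \<mu> $ i $ j \<ge> 0) \<and>
           (\<Sum>j\<in>J i. \<mu> $ i $ j * g i j x (y $ i)) = 0)}"

definition local_solution :: "('a::topological_space \<Rightarrow> real) \<Rightarrow> 'a set \<Rightarrow> 'a \<Rightarrow> bool" where
  "local_solution f F p \<longleftrightarrow> p \<in> F \<and> (\<exists>U. open U \<and> p \<in> U \<and> (\<forall>q\<in>F \<inter> U. f p \<le> f q))"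

end

theory Submission
  imports Defs
begin

text \<open>
  The proof compares the feasible sets of the two problems. For a convex follower the KKT system
  is sufficient for optimality (\<open>KKT_imp_minimizer\<close>). Hence every feasible point of the MPCC,
  whatever its leader decision, projects onto a feasible point of the game, and the projection forgets only \<open>\<mu>\<close>,
  on which the objective does not depend. If \<open>U\<close> is a neighbourhood in which
  \<open>(xbar, ybar)\<close> is optimal for the game, the cylinder of all \<open>(x, y, \<mu>)\<close> with \<open>(x, y) \<in> U\<close>
  therefore witnesses local optimality of \<open>(xbar, ybar, \<mu>)\<close> for every \<open>\<mu>\<close> that makes this
  triple feasible.

  What remains is that such a \<open>\<mu>\<close> exists, and this concerns the single point
  \<open>(xbar, ybar)\<close>. The multipliers of one follower come from separating the origin from the
  set of points that lie strictly above the pair (increase of the objective, constraint values)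
  of some strategy (\<open>slater_imp_lagrange_multipliers\<close>); Slater's condition at \<open>xbar\<close>
  prevents the separating hyperplane from being vertical. The follower's decision then minimizes
  the Lagrangian over the whole strategy subspace, so the gradient of the Lagrangian vanishes.
\<close>

section \<open>Differentiable functions on a subspace\<close>

lemma has_real_derivative_along_line:
  fixes f :: "'a::euclidean_space \<Rightarrow> real"
  assumes S: "subspace S" and v: "v \<in> S" and w: "w \<in> S"
    and f: "(f has_derivative (\<lambda>h. G \<bullet> h)) (at v within S)"
  shows "((\<lambda>t. f (v + t *\<^sub>R w)) has_real_derivative G \<bullet> w) (at 0)"
proof -
  have line: "((\<lambda>t::real. v + t *\<^sub>R w) has_derivative (\<lambda>t. t *\<^sub>R w)) (at 0)"
    by (auto intro!: derivative_eq_intros)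
  have "range (\<lambda>t::real. v + t *\<^sub>R w) \<subseteq> S"
    using S v w by (auto intro!: subspace_add subspace_scale)
  from has_derivative_subset[OF f this]
  have "(f has_derivative (\<lambda>h. G \<bullet> h)) (at (v + 0 *\<^sub>R w) within range (\<lambda>t::real. v + t *\<^sub>R w))"
    by simp
  from has_derivative_in_compose[OF line this] show ?thesis
    by (simp add: has_field_derivative_def mult.commute[of _ "G \<bullet> w"])
qed

lemma convex_on_subspace_above_tangent:
  fixes f :: "'a::euclidean_space \<Rightarrow> real"
  assumes S: "subspace S" and v: "v \<in> S" and z: "z \<in> S"
    and f: "(f has_derivative (\<lambda>h. G \<bullet> h)) (at v within S)" and convex: "convex_on S f"
  shows "f v + G \<bullet> (z - v) \<le> f z"
proof -
  define w where "w = z - v"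
  have w: "w \<in> S" unfolding w_def using S z v by (rule subspace_diff)
  have in_S: "v + t *\<^sub>R w \<in> S" for t
    using S v w by (intro subspace_add subspace_scale)
  have "convex_on UNIV (\<lambda>t. f (v + t *\<^sub>R w))"
  proof (rule convex_onI)
    fix t a b :: real assume t: "0 < t" "t < 1"
    have "v + ((1 - t) *\<^sub>R a + t *\<^sub>R b) *\<^sub>R w
        = (1 - t) *\<^sub>R (v + a *\<^sub>R w) + t *\<^sub>R (v + b *\<^sub>R w)"
      by (simp add: algebra_simps)
    then show "f (v + ((1 - t) *\<^sub>R a + t *\<^sub>R b) *\<^sub>R w)
        \<le> (1 - t) * f (v + a *\<^sub>R w) + t * f (v + b *\<^sub>R w)"
      using convex_onD[OF convex _ _ in_S in_S] t by simp
  qed simp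
  from convex_on_imp_above_tangent[OF this, of 0 1 "G \<bullet> w"]
  show ?thesis
    using has_real_derivative_along_line[OF S v w f] by (simp add: w_def)
qed

text \<open>As \<open>G \<in> S\<close>, one may move in the direction \<open>G\<close>; this gives \<open>G \<bullet> G = 0\<close>.\<close>

lemma minimizer_on_subspace_imp_grad_eq_0:
  fixes f :: "'a::euclidean_space \<Rightarrow> real"
  assumes S: "subspace S" and v: "v \<in> S" and G: "G \<in> S"
    and f: "(f has_derivative (\<lambda>h. G \<bullet> h)) (at v within S)"
    and min: "\<And>z. z \<in> S \<Longrightarrow> f v \<le> f z"
  shows "G = 0"
proof -
  have "v + t *\<^sub>R G \<in> S" for t
    using S v G by (intro subspace_add subspace_scale)
  then have "\<forall>t. \<bar>0 - t\<bar> < 1 \<longrightarrow> f (v + 0 *\<^sub>R G) \<le> f (v + t *\<^sub>R G)"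
    using min by simp
  from DERIV_local_min[OF has_real_derivative_along_line[OF S v G f] zero_less_one this]
  show ?thesis by simp
qed

section \<open>Optimality conditions for a convex problem\<close>

text \<open>
  Summing the tangent inequalities of \<open>f\<close> and, with weights \<open>\<mu> j\<close>, those of the constraints
  cancels the gradient terms.
\<close>

lemma KKT_imp_minimizer:
  fixes f :: "'a::euclidean_space \<Rightarrow> real"
  assumes S: "subspace S" and v: "v \<in> S" and z: "z \<in> S"
    and f: "(f has_derivative (\<lambda>h. F \<bullet> h)) (at v within S)" "convex_on S f"
    and g: "\<And>j. j \<in> J \<Longrightarrow> (g j has_derivative (\<lambda>h. G j \<bullet> h)) (at v within S)"
      "\<And>j. j \<in> J \<Longrightarrow> convex_on S (g j)"
    and stationary: "F + (\<Sum>j\<in>J. \<mu> j *\<^sub>R G j) = 0"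
    and nonneg: "\<And>j. j \<in> J \<Longrightarrow> \<mu> j \<ge> 0"
    and compl: "(\<Sum>j\<in>J. \<mu> j * g j v) = 0"
    and z_feasible: "\<And>j. j \<in> J \<Longrightarrow> g j z \<le> 0"
  shows "f v \<le> f z"
proof -
  have "(\<Sum>j\<in>J. \<mu> j * (g j v + G j \<bullet> (z - v))) \<le> (\<Sum>j\<in>J. 0)"
  proof (rule sum_mono)
    fix j assume j: "j \<in> J"
    have "g j v + G j \<bullet> (z - v) \<le> 0"
      using convex_on_subspace_above_tangent[OF S v z g(1)[OF j] g(2)[OF j]] z_feasible[OF j]
      by linarith
    then show "\<mu> j * (g j v + G j \<bullet> (z - v)) \<le> 0"
      by (rule mult_nonneg_nonpos[OF nonneg[OF j]])
  qed
  then have "(\<Sum>j\<in>J. \<mu> j *\<^sub>R G j) \<bullet> (z - v) \<le> 0"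
    using compl by (simp add: distrib_left sum.distrib inner_sum_left)
  moreover have "F \<bullet> (z - v) + (\<Sum>j\<in>J. \<mu> j *\<^sub>R G j) \<bullet> (z - v) = 0"
    using stationary by (simp flip: inner_add_left)
  ultimately show ?thesis
    using convex_on_subspace_above_tangent[OF S v z f] by linarith
qed

text \<open>
  This is strong Lagrangian duality. The set \<open>C\<close> of pairs \<open>(a, u)\<close> such that some \<open>z \<in> S\<close>
  has objective value below \<open>c + a\<close> and constraint values below \<open>u\<close> is convex, and it misses the origin because \<open>c\<close> is a lower bound
  of the optimal value. A hyperplane through the origin with \<open>C\<close> on one side has a normal
  \<open>(l, w)\<close> with nonnegative components, as \<open>C\<close> is closed under increasing coordinates. If
  \<open>l\<close> were zero, the value of the functional at a Slater point would be negative; so one may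
  divide by \<open>l\<close>. Components of \<open>u\<close> outside \<open>J\<close> are unrestricted in \<open>C\<close>, hence \<open>w\<close> vanishes
  there.
\<close>

lemma slater_imp_lagrange_multipliers:
  fixes f :: "'a::real_vector \<Rightarrow> real" and g :: "'j::finite \<Rightarrow> 'a \<Rightarrow> real"
  assumes f: "convex_on S f" and g: "\<And>j. j \<in> J \<Longrightarrow> convex_on S (g j)"
    and lower_bound: "\<And>z. z \<in> S \<Longrightarrow> (\<And>j. j \<in> J \<Longrightarrow> g j z \<le> 0) \<Longrightarrow> c \<le> f z"
    and s: "s \<in> S" and slater: "\<And>j. j \<in> J \<Longrightarrow> g j s < 0"
  obtains \<mu> :: "real ^ 'j"
  where "\<And>j. \<mu> $ j \<ge> 0" "\<And>j. j \<notin> J \<Longrightarrow> \<mu> $ j = 0"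
    and "\<And>z. z \<in> S \<Longrightarrow> c \<le> f z + (\<Sum>j\<in>J. \<mu> $ j * g j z)"
proof -
  define C :: "(real \<times> (real ^ 'j)) set"
    where "C = {(a, u). \<exists>z\<in>S. f z < c + a \<and> (\<forall>j\<in>J. g j z < u $ j)}"
  have strict: "(1 - t) * p + t * q < (1 - t) * p' + t * q'"
    if "0 < t" "t < 1" "p < p'" "q < q'" for t p q p' q' :: real
    using that by (intro add_strict_mono mult_strict_left_mono) auto
  have "convex C"
    unfolding convex_alt
  proof (intro ballI allI impI)
    fix p q and t :: real
    assume p: "p \<in> C" and q: "q \<in> C" and "0 \<le> t \<and> t \<le> 1"
    then consider "t = 0" | "t = 1" | "0 < t" "t < 1" by fastforce
    then show "(1 - t) *\<^sub>R p + t *\<^sub>R q \<in> C"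
    proof cases
      case 3
      obtain a u y where y: "p = (a, u)" "y \<in> S" "f y < c + a" "\<And>j. j \<in> J \<Longrightarrow> g j y < u $ j"
        using p by (auto simp: C_def)
      obtain b v z where z: "q = (b, v)" "z \<in> S" "f z < c + b" "\<And>j. j \<in> J \<Longrightarrow> g j z < v $ j"
        using q by (auto simp: C_def)
      let ?z = "(1 - t) *\<^sub>R y + t *\<^sub>R z"
      have "?z \<in> S"
        using convex_on_imp_convex[OF f] y(2) z(2) 3 by (simp add: convex_alt)
      moreover have "f ?z < c + ((1 - t) * a + t * b)"
      proof -
        have "f ?z \<le> (1 - t) * f y + t * f z"
          using convex_onD[OF f _ _ y(2) z(2)] 3 by simp
        also have "\<dots> < (1 - t) * (c + a) + t * (c + b)"
          using 3 y(3) z(3) by (rule strict)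
        finally show ?thesis by (simp add: algebra_simps)
      qed
      moreover have "g j ?z < (1 - t) * u $ j + t * v $ j" if j: "j \<in> J" for j
      proof -
        have "g j ?z \<le> (1 - t) * g j y + t * g j z"
          using convex_onD[OF g[OF j] _ _ y(2) z(2)] 3 by simp
        also have "\<dots> < (1 - t) * u $ j + t * v $ j"
          using 3 y(4)[OF j] z(4)[OF j] by (rule strict)
        finally show ?thesis .
      qed
      ultimately show ?thesis
        unfolding y(1) z(1) C_def by auto
    qed (use p q in auto)
  qed
  moreover have "0 \<notin> C"
    unfolding C_def zero_prod_def using lower_bound by (force simp: less_imp_le)
  ultimately obtain n where "n \<noteq> 0" and sep: "\<And>p. p \<in> C \<Longrightarrow> 0 \<le> n \<bullet> p"
    using separating_hyperplane_set_0 by metis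
  obtain l w where n: "n = (l, w)" by (cases n)
  with \<open>n \<noteq> 0\<close> have nonzero: "l \<noteq> 0 \<or> w \<noteq> 0"
    by (auto simp: zero_prod_def)

  \<comment> \<open>The strict inequalities that define \<open>C\<close> become weak ones in the limit of shifting all
    coordinates by \<open>e > 0\<close>.\<close>
  have limit: "0 \<le> l * a + (\<Sum>j\<in>UNIV. w $ j * u $ j)"
    if z: "z \<in> S" and a: "f z \<le> c + a" and u: "\<And>j. j \<in> J \<Longrightarrow> g j z \<le> u $ j" for z a u
  proof -
    have "((\<lambda>e. l * (a + e) + (\<Sum>j\<in>UNIV. w $ j * (u $ j + e))) \<longlongrightarrow>
        l * (a + 0) + (\<Sum>j\<in>UNIV. w $ j * (u $ j + 0))) (at_right 0)"
      by (intro tendsto_intros)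
    moreover have "\<forall>\<^sub>F e in at_right 0. 0 \<le> l * (a + e) + (\<Sum>j\<in>UNIV. w $ j * (u $ j + e))"
      using eventually_at_right_less
    proof eventually_elim
      case (elim e)
      have "g j z < u $ j + e" if "j \<in> J" for j
        using u[OF that] elim by linarith
      then have "(a + e, \<chi> j. u $ j + e) \<in> C"
        unfolding C_def using z a elim by (auto intro!: bexI[of _ z])
      from sep[OF this] show ?case by (simp add: n inner_vec_def)
    qed
    ultimately have "0 \<le> l * (a + 0) + (\<Sum>j\<in>UNIV. w $ j * (u $ j + 0))"
      by (intro tendsto_lowerbound) auto
    then show ?thesis by simp
  qed

  \<comment> \<open>Starting from the values at \<open>s\<close>, raising one coordinate far enough would make the
    functional negative if the corresponding component of the normal were negative. For
    \<open>j \<notin> J\<close> the coordinate may be lowered as well.\<close>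
  have unbounded: "0 \<le> b" if "\<And>t. 0 \<le> t \<Longrightarrow> 0 \<le> a + b * t" for a b :: real
  proof (rule ccontr)
    assume "\<not> 0 \<le> b"
    then have "b * ((\<bar>a\<bar> + 1) / - b) = - (\<bar>a\<bar> + 1)" by simp
    then have "a + b * ((\<bar>a\<bar> + 1) / - b) < 0" by linarith
    moreover have "0 \<le> (\<bar>a\<bar> + 1) / - b" using \<open>\<not> 0 \<le> b\<close> by (intro divide_nonneg_pos) auto
    ultimately show False using that by fastforce
  qed
  define k where "k = (\<Sum>j\<in>UNIV. w $ j * g j s)"
  have "0 \<le> l"
  proof (rule unbounded)
    fix t :: real assume "0 \<le> t"
    then show "0 \<le> (l * (f s - c) + k) + l * t"
      using limit[OF s, of "f s - c + t" "\<chi> j. g j s"] by (simp add: k_def algebra_simps)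
  qed
  have shift: "0 \<le> (l * (f s - c) + k) + w $ i * t" if "0 \<le> t \<or> i \<notin> J" for i t
  proof -
    have "0 \<le> l * (f s - c) + (\<Sum>j\<in>UNIV. w $ j * (\<chi> j. g j s + (if j = i then t else 0)) $ j)"
      using that by (intro limit[OF s]) auto
    also have "(\<Sum>j\<in>UNIV. w $ j * (\<chi> j. g j s + (if j = i then t else 0)) $ j) = k + w $ i * t"
      by (simp add: k_def distrib_left sum.distrib if_distrib[of "(*) _"] cong: if_cong)
    finally show ?thesis by simp
  qed
  have w_nonneg: "0 \<le> w $ i" for i
    using shift[of _ i] by (rule unbounded) blast
  have w_outside: "w $ i = 0" if i: "i \<notin> J" for i
  proof -
    have "0 \<le> - w $ i"
    proof (rule unbounded)
      fix t :: real
      show "0 \<le> (l * (f s - c) + k) + (- w $ i) * t"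
        using shift[of "- t" i] i by simp
    qed
    then show ?thesis using w_nonneg[of i] by simp
  qed
  have fritz_john: "0 \<le> l * (f z - c) + (\<Sum>j\<in>J. w $ j * g j z)" if "z \<in> S" for z
  proof -
    have "(\<Sum>j\<in>UNIV. w $ j * g j z) = (\<Sum>j\<in>J. w $ j * g j z)"
      by (rule sum.mono_neutral_right) (auto simp: w_outside)
    then show ?thesis
      using limit[OF that, of "f z - c" "\<chi> j. g j z"] by simp
  qed
  have "l \<noteq> 0"
  proof
    assume "l = 0"
    with nonzero obtain i where i: "w $ i \<noteq> 0" by (auto simp: vec_eq_iff)
    then have "i \<in> J" using w_outside by blast
    have "(\<Sum>j\<in>J. w $ j * g j s) < (\<Sum>j\<in>J. 0)"
    proof (rule sum_strict_mono_ex1)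
      show "\<forall>j\<in>J. w $ j * g j s \<le> 0"
        using w_nonneg slater by (auto intro!: mult_nonneg_nonpos intro: less_imp_le)
      show "\<exists>j\<in>J. w $ j * g j s < 0"
        using i \<open>i \<in> J\<close> w_nonneg[of i] slater by (intro bexI[of _ i] mult_pos_neg) auto
    qed simp
    then show False using fritz_john[OF s] \<open>l = 0\<close> by simp
  qed
  with \<open>0 \<le> l\<close> have "0 < l" by simp
  show ?thesis
  proof
    show "(\<chi> j. w $ j / l) $ j \<ge> 0" for j
      using w_nonneg \<open>0 < l\<close> by simp
    show "(\<chi> j. w $ j / l) $ j = 0" if "j \<notin> J" for j
      using w_outside[OF that] by simp
    show "c \<le> f z + (\<Sum>j\<in>J. (\<chi> j. w $ j / l) $ j * g j z)" if "z \<in> S" for z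
      using fritz_john[OF that] \<open>0 < l\<close> by (simp add: field_simps flip: sum_divide_distrib)
  qed
qed

text \<open>
  Taking the minimal value \<open>f v\<close> as the lower bound, the duality inequality at \<open>z = v\<close> forces
  complementarity, and then says that \<open>v\<close> minimizes the Lagrangian over the whole subspace.
\<close>

lemma minimizer_imp_KKT:
  fixes f :: "'a::euclidean_space \<Rightarrow> real" and g :: "'j::finite \<Rightarrow> 'a \<Rightarrow> real"
  assumes S: "subspace S" and v: "v \<in> S"
    and f: "F \<in> S" "(f has_derivative (\<lambda>h. F \<bullet> h)) (at v within S)" "convex_on S f"
    and g: "\<And>j. j \<in> J \<Longrightarrow> G j \<in> S"
      "\<And>j. j \<in> J \<Longrightarrow> (g j has_derivative (\<lambda>h. G j \<bullet> h)) (at v within S)"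
      "\<And>j. j \<in> J \<Longrightarrow> convex_on S (g j)"
    and v_feasible: "\<And>j. j \<in> J \<Longrightarrow> g j v \<le> 0"
    and min: "\<And>z. z \<in> S \<Longrightarrow> (\<And>j. j \<in> J \<Longrightarrow> g j z \<le> 0) \<Longrightarrow> f v \<le> f z"
    and s: "s \<in> S" and slater: "\<And>j. j \<in> J \<Longrightarrow> g j s < 0"
  obtains \<mu> :: "real ^ 'j"
  where "\<And>j. \<mu> $ j \<ge> 0" "\<And>j. j \<notin> J \<Longrightarrow> \<mu> $ j = 0"
    and "F + (\<Sum>j\<in>J. (\<mu> $ j) *\<^sub>R G j) = 0" "(\<Sum>j\<in>J. \<mu> $ j * g j v) = 0"
proof -
  obtain \<mu> :: "real ^ 'j" where \<mu>: "\<And>j. \<mu> $ j \<ge> 0" "\<And>j. j \<notin> J \<Longrightarrow> \<mu> $ j = 0"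
    and lagrange: "\<And>z. z \<in> S \<Longrightarrow> f v \<le> f z + (\<Sum>j\<in>J. \<mu> $ j * g j z)"
  proof (rule slater_imp_lagrange_multipliers[where S = S and f = f and J = J and g = g
        and c = "f v" and s = s])
    show "f v \<le> f z" if "z \<in> S" "\<And>j. j \<in> J \<Longrightarrow> g j z \<le> 0" for z
      using that by (rule min)
  qed (rule f(3) g(3) s slater that; blast)+
  have "(\<Sum>j\<in>J. \<mu> $ j * g j v) \<le> 0"
    using \<mu>(1) v_feasible by (intro sum_nonpos mult_nonneg_nonpos)
  with lagrange[OF v] have compl: "(\<Sum>j\<in>J. \<mu> $ j * g j v) = 0" by linarith
  have "F + (\<Sum>j\<in>J. (\<mu> $ j) *\<^sub>R G j) = 0"
  proof (rule minimizer_on_subspace_imp_grad_eq_0[OF S v])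
    show "F + (\<Sum>j\<in>J. (\<mu> $ j) *\<^sub>R G j) \<in> S"
      using S f(1) g(1) by (intro subspace_add subspace_sum subspace_scale)
    have "((\<lambda>z. f z + (\<Sum>j\<in>J. \<mu> $ j * g j z)) has_derivative
        (\<lambda>h. F \<bullet> h + (\<Sum>j\<in>J. \<mu> $ j * (G j \<bullet> h)))) (at v within S)"
      using f(2) g(2) by (intro has_derivative_add has_derivative_sum has_derivative_mult_right)
    then show "((\<lambda>z. f z + (\<Sum>j\<in>J. \<mu> $ j * g j z)) has_derivative
        (\<lambda>h. (F + (\<Sum>j\<in>J. (\<mu> $ j) *\<^sub>R G j)) \<bullet> h)) (at v within S)"
      by (simp add: inner_add_left inner_sum_left)
    show "f v + (\<Sum>j\<in>J. \<mu> $ j * g j v) \<le> f z + (\<Sum>j\<in>J. \<mu> $ j * g j z)" if "z \<in> S" for z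
      using lagrange[OF that] compl by simp
  qed
  with \<mu> compl show thesis by (intro that)
qed

section \<open>Feasible points of the game and of the MPCC\<close>

lemma deviate_same: "deviate y i (y $ i) = y"
  by (simp add: deviate_def vec_eq_iff)

lemma profilesD: "y \<in> profiles D \<Longrightarrow> y $ i \<in> coord_space (D i)"
  by (simp add: profiles_def)

text \<open>
  Applied at leader decisions near \<open>xbar\<close>, this is what makes every competitor of
  \<open>(xbar, ybar, \<mu>)\<close> in the MPCC a competitor of \<open>(xbar, ybar)\<close> in the game.
\<close>

lemma MPCC_feasible_imp_SLMFG_feasible:
  fixes D :: "'f::finite \<Rightarrow> 'd::finite set" and J :: "'f \<Rightarrow> 'j::finite set"
  assumes \<theta>_differentiable: "\<And>i x y. y \<in> profiles D \<Longrightarrow>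
      (\<lambda>z. \<theta> i x (deviate y i z)) differentiable_on coord_space (D i)"
    and g_differentiable: "\<And>i j x. j \<in> J i \<Longrightarrow> g i j x differentiable_on coord_space (D i)"
    and \<theta>_convex: "\<And>i x y. y \<in> profiles D \<Longrightarrow>
      convex_on (coord_space (D i)) (\<lambda>z. \<theta> i x (deviate y i z))"
    and g_convex: "\<And>i j x. j \<in> J i \<Longrightarrow> convex_on (coord_space (D i)) (g i j x)"
    and feas: "(x, y, \<mu>) \<in> MPCC_feasible X D J \<theta> g"
  shows "(x, y) \<in> SLMFG_feasible X D J \<theta> g"
proof -
  have y: "y \<in> profiles D" using feas by (simp add: MPCC_feasible_def)
  have "\<theta> i x y \<le> \<theta> i x (deviate y i z)" if z: "z \<in> feasible (D i) (J i) (g i) x" for i z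
  proof -
    let ?S = "coord_space (D i)"
    have yi: "y $ i \<in> ?S" using y by (rule profilesD)
    have "\<theta> i x (deviate y i (y $ i)) \<le> \<theta> i x (deviate y i z)"
    proof (rule KKT_imp_minimizer[OF subspace_coord_space yi, where J = "J i" and g = "\<lambda>j. g i j x"
          and \<mu> = "\<lambda>j. \<mu> $ i $ j" and f = "\<lambda>z. \<theta> i x (deviate y i z)"])
      show "((\<lambda>z. \<theta> i x (deviate y i z)) has_derivative
          (\<lambda>h. grad_on ?S (\<lambda>z. \<theta> i x (deviate y i z)) (y $ i) \<bullet> h)) (at (y $ i) within ?S)"
        using \<theta>_differentiable[OF y] yi
        by (intro grad_on_coord_space(2)) (auto simp: differentiable_on_def)
      show "(g i j x has_derivative (\<lambda>h. grad_on ?S (g i j x) (y $ i) \<bullet> h)) (at (y $ i) within ?S)"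
        if "j \<in> J i" for j
        using g_differentiable[OF that] yi
        by (intro grad_on_coord_space(2)) (auto simp: differentiable_on_def)
    qed (use feas z \<theta>_convex[OF y] g_convex in \<open>auto simp: MPCC_feasible_def feasible_def\<close>)
    then show ?thesis by (simp add: deviate_same)
  qed
  then show ?thesis
    using feas profilesD[OF y]
    by (simp add: MPCC_feasible_def SLMFG_feasible_def NEP_def feasible_def)
qed

lemma SLMFG_feasible_imp_MPCC_feasible:
  fixes D :: "'f::finite \<Rightarrow> 'd::finite set" and J :: "'f \<Rightarrow> 'j::finite set"
  assumes \<theta>_differentiable: "\<And>i. (\<lambda>z. \<theta> i x (deviate y i z)) differentiable_on coord_space (D i)"
    and g_differentiable: "\<And>i j. j \<in> J i \<Longrightarrow> g i j x differentiable_on coord_space (D i)"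
    and \<theta>_convex: "\<And>i. convex_on (coord_space (D i)) (\<lambda>z. \<theta> i x (deviate y i z))"
    and g_convex: "\<And>i j. j \<in> J i \<Longrightarrow> convex_on (coord_space (D i)) (g i j x)"
    and feas: "(x, y) \<in> SLMFG_feasible X D J \<theta> g"
    and Slater: "\<And>i. slater (D i) (J i) (g i) x"
  shows "\<exists>\<mu>. (x, y, \<mu>) \<in> MPCC_feasible X D J \<theta> g"
proof -
  let ?S = "\<lambda>i. coord_space (D i)"
  let ?F = "\<lambda>i. grad_on (?S i) (\<lambda>z. \<theta> i x (deviate y i z)) (y $ i)"
  let ?G = "\<lambda>i j. grad_on (?S i) (g i j x) (y $ i)"
  have y: "y \<in> profiles D" and y_feasible: "\<And>i. y $ i \<in> feasible (D i) (J i) (g i) x"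
    and nash: "\<And>i z. z \<in> feasible (D i) (J i) (g i) x \<Longrightarrow> \<theta> i x y \<le> \<theta> i x (deviate y i z)"
    using feas by (auto simp: SLMFG_feasible_def NEP_def)
  define KKT :: "'f \<Rightarrow> real ^ 'j \<Rightarrow> bool" where "KKT i m \<longleftrightarrow>
      (\<forall>j. m $ j \<ge> 0) \<and> (\<forall>j. j \<notin> J i \<longrightarrow> m $ j = 0) \<and>
      ?F i + (\<Sum>j\<in>J i. (m $ j) *\<^sub>R ?G i j) = 0 \<and>
      (\<Sum>j\<in>J i. m $ j * g i j x (y $ i)) = 0" for i m
  have "\<exists>m. KKT i m" for i
  proof -
    have yi: "y $ i \<in> ?S i" using y by (rule profilesD)
    obtain s where s: "s \<in> ?S i" "\<And>j. j \<in> J i \<Longrightarrow> g i j x s < 0"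
      using Slater[of i] by (auto simp: slater_def)
    note dF = grad_on_coord_space[OF yi, of "\<lambda>z. \<theta> i x (deviate y i z)"]
    have \<theta>_diff: "(\<lambda>z. \<theta> i x (deviate y i z)) differentiable (at (y $ i) within ?S i)"
      using \<theta>_differentiable yi by (auto simp: differentiable_on_def)
    have g_diff: "g i j x differentiable (at (y $ i) within ?S i)" if "j \<in> J i" for j
      using g_differentiable[OF that] yi by (auto simp: differentiable_on_def)
    obtain m :: "real ^ 'j" where "\<And>j. m $ j \<ge> 0" "\<And>j. j \<notin> J i \<Longrightarrow> m $ j = 0"
      "?F i + (\<Sum>j\<in>J i. (m $ j) *\<^sub>R ?G i j) = 0" "(\<Sum>j\<in>J i. m $ j * g i j x (y $ i)) = 0"
    proof (rule minimizer_imp_KKT[OF subspace_coord_space yi dF(1)[OF \<theta>_diff] dF(2)[OF \<theta>_diff]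
          \<theta>_convex, where J = "J i" and g = "\<lambda>j. g i j x" and G = "?G i" and s = s])
      show "?G i j \<in> ?S i"
        "(g i j x has_derivative (\<lambda>h. ?G i j \<bullet> h)) (at (y $ i) within ?S i)" if "j \<in> J i" for j
        by (rule grad_on_coord_space[OF yi g_diff[OF that]])+
      show "g i j x (y $ i) \<le> 0" if "j \<in> J i" for j
        using y_feasible[of i] that by (simp add: feasible_def)
      show "\<theta> i x (deviate y i (y $ i)) \<le> \<theta> i x (deviate y i z)"
        if "z \<in> ?S i" "\<And>j. j \<in> J i \<Longrightarrow> g i j x z \<le> 0" for z
        using nash[of z i] that by (simp add: feasible_def deviate_same)
    qed (use g_convex s in auto)
    then show ?thesis unfolding KKT_def by blast
  qed
  then obtain m where KKT: "\<And>i. KKT i (m i)"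
    by metis
  then have m: "m i $ j \<ge> 0" "j \<notin> J i \<Longrightarrow> m i $ j = 0"
    "?F i + (\<Sum>j\<in>J i. (m i $ j) *\<^sub>R ?G i j) = 0"
    "(\<Sum>j\<in>J i. m i $ j * g i j x (y $ i)) = 0" for i j
    unfolding KKT_def by blast+
  have "(\<chi> i. m i) \<in> profiles J"
    using m(2) by (simp add: profiles_def coord_space_def)
  then have "(x, y, \<chi> i. m i) \<in> MPCC_feasible X D J \<theta> g"
    using feas y y_feasible m(1,3,4)
    by (simp add: MPCC_feasible_def SLMFG_feasible_def feasible_def)
  then show ?thesis ..
qed

section \<open>Local solutions\<close>

theorem theorem2:
  fixes X :: "(real ^ 'm::finite) set"
    and D :: "'f::finite \<Rightarrow> 'd::finite set"
    and J :: "'f \<Rightarrow> 'j::finite set"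
    and \<theta>0 :: "real ^ 'm \<Rightarrow> (real ^ 'd) ^ 'f \<Rightarrow> real"
    and \<theta> :: "'f \<Rightarrow> real ^ 'm \<Rightarrow> (real ^ 'd) ^ 'f \<Rightarrow> real"
    and g :: "'f \<Rightarrow> 'j \<Rightarrow> real ^ 'm \<Rightarrow> real ^ 'd \<Rightarrow> real"
    and xbar :: "real ^ 'm"
    and ybar :: "(real ^ 'd) ^ 'f"
  assumes \<theta>_differentiable: "\<And>i x y. y \<in> profiles D \<Longrightarrow>
      (\<lambda>z. \<theta> i x (deviate y i z)) differentiable_on coord_space (D i)"
    and \<theta>_grad_continuous: "\<And>i. continuous_on (UNIV \<times> profiles D)
      (\<lambda>(x, y). grad_on (coord_space (D i)) (\<lambda>z. \<theta> i x (deviate y i z)) (y $ i))"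
    and g_differentiable: "\<And>i j x. j \<in> J i \<Longrightarrow> g i j x differentiable_on coord_space (D i)"
    and g_grad_continuous: "\<And>i j. j \<in> J i \<Longrightarrow> continuous_on (UNIV \<times> coord_space (D i))
      (\<lambda>(x, v). grad_on (coord_space (D i)) (g i j x) v)"
    and \<theta>_convex: "\<And>i x y. y \<in> profiles D \<Longrightarrow>
      convex_on (coord_space (D i)) (\<lambda>z. \<theta> i x (deviate y i z))"
    and g_convex: "\<And>i j x. j \<in> J i \<Longrightarrow> convex_on (coord_space (D i)) (g i j x)"
    and SLMFG_sol: "local_solution (\<lambda>(x, y). \<theta>0 x y) (SLMFG_feasible X D J \<theta> g) (xbar, ybar)"
    and Slater: "\<And>i. slater (D i) (J i) (g i) xbar"
  shows "\<exists>\<mu>bar :: (real ^ 'j) ^ 'f. (\<forall>i. \<forall>j\<in>J i. \<mu>bar $ i $ j \<ge> 0) \<and>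
    local_solution (\<lambda>(x, y, \<mu>). \<theta>0 x y) (MPCC_feasible X D J \<theta> g) (xbar, ybar, \<mu>bar)"
proof -
  let ?M = "MPCC_feasible X D J \<theta> g"
  obtain U where feas: "(xbar, ybar) \<in> SLMFG_feasible X D J \<theta> g"
    and U: "open U" "(xbar, ybar) \<in> U"
    and opt: "\<forall>(x, y) \<in> SLMFG_feasible X D J \<theta> g \<inter> U. \<theta>0 xbar ybar \<le> \<theta>0 x y"
    using SLMFG_sol by (auto simp: local_solution_def case_prod_unfold)
  have ybar: "ybar \<in> profiles D"
    using feas by (simp add: SLMFG_feasible_def NEP_def)
  obtain \<mu> where \<mu>: "(xbar, ybar, \<mu>) \<in> ?M"
    using SLMFG_feasible_imp_MPCC_feasible[OF \<theta>_differentiable[OF ybar] g_differentiable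
        \<theta>_convex[OF ybar] g_convex feas Slater] by blast
  define V :: "((real ^ 'm) \<times> ((real ^ 'd) ^ 'f) \<times> ((real ^ 'j) ^ 'f)) set"
    where "V = (\<lambda>(x, y, \<mu>). (x, y)) -` U"
  have "open V"
    unfolding V_def case_prod_unfold using U(1) by (intro open_vimage continuous_intros)
  moreover have "(xbar, ybar, \<mu>) \<in> V"
    using U(2) by (simp add: V_def)
  moreover have "\<theta>0 xbar ybar \<le> \<theta>0 x y" if "(x, y, \<nu>) \<in> ?M \<inter> V" for x y \<nu>
  proof -
    have "(x, y) \<in> SLMFG_feasible X D J \<theta> g"
    proof (rule MPCC_feasible_imp_SLMFG_feasible)
      show "(x, y, \<nu>) \<in> ?M" using that by blast
    qed (fact \<theta>_differentiable g_differentiable \<theta>_convex g_convex)+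
    moreover have "(x, y) \<in> U" using that by (simp add: V_def)
    ultimately show ?thesis using opt by blast
  qed
  ultimately have "local_solution (\<lambda>(x, y, \<mu>). \<theta>0 x y) ?M (xbar, ybar, \<mu>)"
    unfolding local_solution_def using \<mu> by (intro conjI exI[of _ V]) auto
  moreover have "\<forall>i. \<forall>j\<in>J i. \<mu> $ i $ j \<ge> 0"
    using \<mu> by (simp add: MPCC_feasible_def)
  ultimately show ?thesis by blast
qed

end
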